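(* Let $d=2$ and let $n\ge 1$ be an integer. (i) If $0<p\le 1$ or $p\in\{2,4,\dots,2n-2\}$, then, among all $n$-element multisets $\omega_n\subset S^1$, the quantity $M^p(\omega_n)$ is minimized by vector sets which are equally distributed on the half-circle. (ii) If $p\in\{2,4,\dots,2n-2\}$, then for any extremal configuration $\omega_n$ (i.e. any $n$-element multiset $\omega_n\subset S^1$ with $M^p(\omega_n)=M_n^p(S^1)$), the potential function $v\mapsto U^p(\omega_n,v)$ is constant on the unit circle. (iii) If $0<p\le 1$, then $$M_n^p(S^1)=\sum_{k=1}^n\left|\cos\left(\frac{k\pi}{n}-\frac{\pi}{2n}\right)\right|^p\quad\text{if } n \text{ is even},$$ and $$M_n^p(S^1)=\sum_{k=1}^n\left|\cos\left(\frac{k\pi}{n}\right)\right|^p\quad\text{if } n \text{ is odd}.$$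
   Context: $S^1$ is the unit circle in $\mathbb{R}^2$, identified with the complex unit circle $T\subset\mathbb{C}$, and $\langle\cdot,\cdot\rangle$ is the standard inner product of $\mathbb{R}^2$. For a multiset $\omega_n=\{u_1,\dots,u_n\}\subset S^1$ (repetitions allowed) and $p>0$, the $\ell_p$-potential at $v\in S^1$ is $U^p(\omega_n,v)=\sum_{i=1}^n|\langle v,u_i\rangle|^p$, the $\ell_p$-polarization is $M^p(\omega_n)=\max_{v\in S^1}U^p(\omega_n,v)$, and $M_n^p(S^1)=\min_{\omega_n\subset S^1}M^p(\omega_n)$, the minimum being over all $n$-element multisets of unit vectors. A vector set is equally distributed on the half-circle if it is of the form $\{e^{i(\alpha+k\pi/n)}: k=0,1,\dots,n-1\}$ for some $\alpha\in\mathbb{R}$ (so that the lines spanned by its vectors are evenly spaced). For $n=1$ the set $\{2,4,\dots,2n-2\}$ is empty. *)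

theory Defs
  imports "HOL-Analysis.Analysis" "HOL-Library.Multiset"
begin

text \<open>
  The plane is represented by the type \<^typ>\<open>complex\<close>, whose inner product is
  \<^prop>\<open>v \<bullet> u = Re v * Re u + Im v * Im u\<close>, and the unit circle by
  \<^term>\<open>sphere 0 1 :: complex set\<close>.
\<close>

definition configs :: "nat \<Rightarrow> complex multiset set" where
  "configs n = {\<omega>. size \<omega> = n \<and> set_mset \<omega> \<subseteq> sphere 0 1}"

definition potential :: "real \<Rightarrow> complex multiset \<Rightarrow> complex \<Rightarrow> real" where
  "potential p \<omega> v = (\<Sum>u\<in>#\<omega>. \<bar>v \<bullet> u\<bar> powr p)"

text \<open>
  For \<^prop>\<open>p > 0\<close> the supremum and the infimum in the next two definitions are attained; see
  \<open>polarization_attained\<close> and \<open>min_polarization_attained\<close> below.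
\<close>

definition polarization :: "real \<Rightarrow> complex multiset \<Rightarrow> real" where
  "polarization p \<omega> = (SUP v\<in>sphere 0 1. potential p \<omega> v)"

definition min_polarization :: "real \<Rightarrow> nat \<Rightarrow> real" where
  "min_polarization p n = (INF \<omega>\<in>configs n. polarization p \<omega>)"

definition equally_distributed_half_circle :: "nat \<Rightarrow> complex multiset \<Rightarrow> bool" where
  "equally_distributed_half_circle n \<omega> \<longleftrightarrow>
     (\<exists>\<alpha>::real. \<omega> = {# cis (\<alpha> + real k * pi / real n). k \<in># mset_set {0..<n} #})"

lemma continuous_on_potential_term:
  fixes f g :: "'a::topological_space \<Rightarrow> complex"
  assumes "p > 0" "continuous_on A f" "continuous_on A g"
  shows "continuous_on A (\<lambda>x. \<bar>f x \<bullet> g x\<bar> powr p)"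
  using assms by (intro continuous_on_powr' continuous_intros) auto

lemma continuous_on_potential:
  assumes "p > 0"
  shows "continuous_on A (potential p \<omega>)"
proof (induction \<omega>)
  case empty
  then show ?case by (simp add: potential_def[abs_def])
next
  case (add u \<omega>)
  have "continuous_on A (\<lambda>v. \<bar>v \<bullet> u\<bar> powr p + potential p \<omega> v)"
    using add assms by (intro continuous_on_add continuous_on_potential_term continuous_intros)
  then show ?case by (simp add: potential_def[abs_def])
qed

lemma polarization_attained:
  assumes "p > 0"
  shows "\<exists>v\<in>sphere 0 1. polarization p \<omega> = potential p \<omega> v \<and>
           (\<forall>w\<in>sphere 0 1. potential p \<omega> w \<le> potential p \<omega> v)"
proof -
  have "sphere (0::complex) 1 \<noteq> {}" by simp
  then obtain v where v: "v \<in> sphere 0 1" "\<forall>w\<in>sphere 0 1. potential p \<omega> w \<le> potential p \<omega> v"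
    using continuous_attains_sup[OF compact_sphere _ continuous_on_potential[OF assms]] by blast
  have "polarization p \<omega> = potential p \<omega> v"
    unfolding polarization_def by (rule cSup_eq_maximum) (use v in auto)
  with v show ?thesis by blast
qed

lemma potential_nonneg: "potential p \<omega> v \<ge> 0"
  by (induction \<omega>) (auto simp: potential_def)

lemma polarization_nonneg: "p > 0 \<Longrightarrow> polarization p \<omega> \<ge> 0"
  using polarization_attained[of p \<omega>] potential_nonneg[of p \<omega>] by auto

lemma potential_le_polarization:
  "p > 0 \<Longrightarrow> v \<in> sphere 0 1 \<Longrightarrow> potential p \<omega> v \<le> polarization p \<omega>"
  using polarization_attained[of p \<omega>] by metis

lemma configs_iff_map:
  "\<omega> \<in> configs n \<longleftrightarrow> (\<exists>f. (\<forall>i. f i \<in> sphere 0 1) \<and> \<omega> = mset (map f [0..<n]))"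
proof
  assume \<omega>: "\<omega> \<in> configs n"
  obtain xs where xs: "mset xs = \<omega>" using ex_mset by blast
  then have len: "length xs = n" and sub: "set xs \<subseteq> sphere 0 1"
    using \<omega> by (auto simp: configs_def)
  define f where "f i = (if i < n then xs ! i else 1)" for i
  have "map f [0..<n] = xs" by (rule nth_equalityI) (auto simp: f_def len)
  moreover have "f i \<in> sphere 0 1" for i
    using sub len nth_mem[of i xs] by (auto simp: f_def simp del: nth_mem dest!: subsetD)
  ultimately show "\<exists>f. (\<forall>i. f i \<in> sphere 0 1) \<and> \<omega> = mset (map f [0..<n])"
    using xs by metis
qed (auto simp: configs_def)

lemma min_polarization_attained:
  assumes "p > 0"
  shows "\<exists>\<omega>\<in>configs n. polarization p \<omega> = min_polarization p n \<and>
           (\<forall>\<omega>'\<in>configs n. polarization p \<omega> \<le> polarization p \<omega>')"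
proof -
  define P where "P f v = potential p (mset (map f [0..<n])) v" for f :: "nat \<Rightarrow> complex" and v
  define m where "m = min_polarization p n"
  define K where "K = (PiE UNIV (\<lambda>_. sphere 0 1) :: (nat \<Rightarrow> complex) set)"
  define F where "F c = (\<Inter>v\<in>sphere 0 1. {f. P f v \<le> c})" for c
  have bdd: "bdd_below (polarization p ` configs n)"
    using polarization_nonneg[OF assms] by (auto simp: bdd_below_def)
  have K_iff: "f \<in> K \<longleftrightarrow> (\<forall>i. f i \<in> sphere 0 1)" for f
    by (auto simp: K_def PiE_def)
  have "compact K"
    using compactin_PiE[of "\<lambda>_. euclidean" UNIV "\<lambda>_::nat. sphere (0::complex) 1"]
    by (simp add: K_def euclidean_product_topology)
  have P_eq: "P f v = (\<Sum>i<n. \<bar>v \<bullet> f i\<bar> powr p)" for f v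
    by (simp add: P_def potential_def mset_map image_mset.compositionality comp_def
          sum_unfold_sum_mset lessThan_atLeast0)
  have clF: "closed (F c)" for c
    unfolding F_def P_eq
    by (intro closed_INT ballI closed_Collect_le continuous_on_sum continuous_on_potential_term
          continuous_intros continuous_on_product_coordinates assms)
  have ne: "K \<inter> F c \<noteq> {}" if c: "c > m" for c
  proof -
    have "replicate_mset n 1 \<in> configs n"
      by (auto simp: configs_def)
    then have "configs n \<noteq> {}" by blast
    then obtain \<omega> where "\<omega> \<in> configs n" "polarization p \<omega> < c"
      using c cINF_less_iff[OF _ bdd, of c] unfolding m_def min_polarization_def by blast
    then obtain f where "f \<in> K" "\<omega> = mset (map f [0..<n])"
      by (auto simp: configs_iff_map K_iff)
    moreover have "potential p \<omega> v \<le> c" if "v \<in> sphere 0 1" for v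
      using potential_le_polarization[OF assms that, of \<omega>] \<open>polarization p \<omega> < c\<close> by linarith
    ultimately have "f \<in> K \<inter> F c" unfolding F_def P_def by simp
    then show ?thesis by blast
  qed
  have "K \<inter> (\<Inter>c\<in>{m<..}. F c) \<noteq> {}"
  proof (rule compact_imp_fip_image[OF \<open>compact K\<close> clF])
    fix I assume I: "finite I" "I \<subseteq> {m<..}"
    have "K \<inter> F (Min (insert (m + 1) I)) \<subseteq> K \<inter> (\<Inter>c\<in>I. F c)"
    proof -
      have "F (Min (insert (m + 1) I)) \<subseteq> F c" if "c \<in> I" for c
      proof -
        have "Min (insert (m + 1) I) \<le> c" using I that by (intro Min_le) auto
        then show ?thesis unfolding F_def using order_trans by blast
      qed
      then show ?thesis by blast
    qed
    moreover have "Min (insert (m + 1) I) > m" using I by auto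
    ultimately show "K \<inter> (\<Inter>c\<in>I. F c) \<noteq> {}" using ne by blast
  qed
  then obtain f where f: "f \<in> K" "\<And>c. c > m \<Longrightarrow> f \<in> F c" by blast
  define \<omega> where "\<omega> = mset (map f [0..<n])"
  have \<omega>: "\<omega> \<in> configs n" using f(1) unfolding configs_iff_map \<omega>_def K_iff by blast
  have "potential p \<omega> v \<le> m" if "v \<in> sphere 0 1" for v
  proof (rule dense_ge)
    fix c assume "m < c"
    then have "f \<in> F c" by (rule f(2))
    then show "potential p \<omega> v \<le> c"
      using that unfolding F_def P_def \<omega>_def by blast
  qed
  then have "polarization p \<omega> \<le> m"
    using polarization_attained[OF assms, of \<omega>] by metis
  moreover have lower: "m \<le> polarization p \<omega>'" if "\<omega>' \<in> configs n" for \<omega>'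
    unfolding m_def min_polarization_def by (rule cINF_lower[OF bdd that])
  ultimately show ?thesis
    using \<omega> lower[OF \<omega>] unfolding m_def[symmetric] by (intro bexI[of _ \<omega>]) auto
qed

end

theory Submission
  imports Defs
begin

text \<open>
  For \<open>p = 2 m\<close> with \<open>m < n\<close>, the sum of \<open>cos\<close> to the power \<open>2 m\<close> over \<open>n\<close> angles in steps
  of \<open>pi / n\<close> does not depend on the starting angle. Hence the mean of the potential over such
  angles is the same for all configurations and bounds the polarization from below, with equality
  only for constant potentials.

  For \<open>p \<le> 1\<close>, the kernel \<open>sin t powr p\<close> is concave on \<open>[0, pi]\<close>. Let \<open>e i\<close> be the difference between
  the \<open>i\<close>-th sorted angle of a configuration, taken modulo \<open>pi\<close>, and \<open>i * pi / n\<close>, centred to mean zero.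
  By the cycle lemma some rotation of \<open>e\<close> has nonnegative partial sums. Seen from the direction this
  rotation selects, the angles are majorized by the equally spaced ones with that direction in the
  middle of a gap, so Karamata's inequality bounds the potential there from below. By concavity and
  symmetry, the equally distributed sets have their maximal potential in this same position.
\<close>

section \<open>Sums over equally spaced angles\<close>

lemma abs_sin_add_int_pi: "\<bar>sin (x + of_int k * pi)\<bar> = \<bar>sin x\<bar>"
proof -
  have sin: "sin (of_int k * pi) = 0"
    by (auto simp: sin_zero_iff_int2)
  then have "\<bar>cos (of_int k * pi)\<bar> = 1"
    using sin_cos_squared_add[of "of_int k * pi"] by (auto simp: power2_eq_1_iff)
  with sin show ?thesis
    by (simp add: sin_add abs_mult)
qed

lemma abs_sin_add_pi: "\<bar>sin (x + pi)\<bar> = \<bar>sin x\<bar>"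
  by simp

text \<open>Moving on by one step drops the first sample and adds one a full period later, which has
  the same value. The induction keeps \<open>x\<close> arbitrary since each step moves the starting
  point.\<close>

lemma sum_equispaced_shift:
  fixes h :: "real \<Rightarrow> real"
  assumes n: "n \<ge> 1" and per: "\<And>x. h (x + L) = h x"
  shows "(\<Sum>i<n. h (x + real i * L / real n + real j * L / real n))
           = (\<Sum>i<n. h (x + real i * L / real n))"
proof (induction j arbitrary: x)
  case (Suc j)
  have L: "real n * L / real n = L"
    using n by simp
  let ?g = "\<lambda>i. h (x + real i * L / real n)"
  have "(\<Sum>i<n. h (x + real i * L / real n + real (Suc j) * L / real n))
          = (\<Sum>i<n. h ((x + L / real n) + real i * L / real n + real j * L / real n))"
    by (intro sum.cong refl arg_cong[where f = h]) (simp add: algebra_simps add_divide_distrib)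
  also have "\<dots> = (\<Sum>i<n. ?g (Suc i))"
    unfolding Suc by (intro sum.cong refl arg_cong[where f = h]) (simp add: algebra_simps add_divide_distrib)
  also have "\<dots> = (\<Sum>i<Suc n. ?g i) - ?g 0"
    by (simp only: sum.lessThan_Suc_shift)
  also have "\<dots> = (\<Sum>i<n. ?g i)"
    using per[of x] L by simp
  finally show ?case .
qed simp

lemma sum_equispaced_shift_int:
  fixes h :: "real \<Rightarrow> real"
  assumes n: "n \<ge> 1" and per: "\<And>x. h (x + L) = h x"
  shows "(\<Sum>i<n. h (x + real i * L / real n + of_int j * L / real n))
           = (\<Sum>i<n. h (x + real i * L / real n))"
proof (cases "j \<ge> 0")
  case True
  then show ?thesis
    using sum_equispaced_shift[of n h L x "nat j", OF n per] by simp
next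
  case False
  \<comment> \<open>For negative \<open>j\<close>, start at the shifted point: \<open>-j\<close>
    forward steps lead from \<open>y\<close> back to \<open>x\<close>.\<close>
  define y where "y = x + of_int j * L / real n"
  have "(\<Sum>i<n. h (y + real i * L / real n + real (nat (-j)) * L / real n))
           = (\<Sum>i<n. h (y + real i * L / real n))"
    by (rule sum_equispaced_shift) (fact n per)+
  then show ?thesis
    using False by (simp add: y_def algebra_simps)
qed

text \<open>A geometric series whose ratio is an \<open>n\<close>-th root of unity; the ratio
  differs from 1 because \<open>n\<close> cannot divide a nonzero \<open>d\<close> with
  \<open>\<bar>d\<bar> < n\<close>.\<close>

lemma sum_cis_equispaced:
  fixes d :: int
  assumes "d \<noteq> 0" "\<bar>d\<bar> < int n"
  shows "(\<Sum>k<n. cis (2 * of_int d * (x + real k * pi / real n))) = 0"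
proof -
  define r where "r = cis (2 * pi * (of_int d / real n))"
  have n: "n > 0" using assms by linarith
  have "r \<noteq> 1"
  proof
    assume "r = 1"
    then have "cos (2 * pi * (of_int d / real n)) = 1"
      by (simp add: r_def complex_eq_iff)
    then obtain m :: int where "2 * pi * (of_int d / real n) = of_int m * 2 * pi"
      by (auto simp: cos_one_2pi_int)
    then have "(2 * pi) * (of_int d / real n) = (2 * pi) * of_int m"
      by (simp only: mult_ac)
    then have "of_int d / real n = of_int m"
      by (subst (asm) mult_cancel_left) simp
    then have "real_of_int d = of_int (m * int n)" using n by (simp add: field_simps)
    then have d: "d = m * int n" by linarith
    then have "m \<noteq> 0" using assms by auto
    then have "1 * int n \<le> \<bar>m\<bar> * int n" by (intro mult_right_mono) auto
    then show False using d assms(2) by (simp add: abs_mult)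
  qed
  have "r ^ n = cis (2 * pi * of_int d)"
    using n by (simp add: r_def Complex.DeMoivre field_simps)
  also have "\<dots> = 1" by (rule cis_multiple_2pi) simp
  finally have rn: "r ^ n = 1" .
  have "(\<Sum>k<n. cis (2 * of_int d * (x + real k * pi / real n)))
          = (\<Sum>k<n. cis (2 * of_int d * x) * r ^ k)"
    by (intro sum.cong refl) (simp add: r_def Complex.DeMoivre cis_mult field_simps)
  also have "\<dots> = cis (2 * of_int d * x) * (\<Sum>k<n. r ^ k)"
    by (simp add: sum_distrib_left)
  also have "\<dots> = 0"
    using \<open>r \<noteq> 1\<close> rn by (simp add: geometric_sum)
  finally show ?thesis .
qed

text \<open>By Euler's formula and the binomial theorem the power has only the frequencies
  \<open>2 * (j - m)\<close> with \<open>\<bar>j - m\<bar> \<le> m < n\<close>. All of them sum to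
  zero except the constant term \<open>j = m\<close>.\<close>

lemma sum_cos_power_equispaced:
  assumes "m < n"
  shows "(\<Sum>k<n. cos (x + real k * pi / real n) ^ (2 * m))
           = real n * real ((2 * m) choose m) / 2 ^ (2 * m)"
proof -
  define y where "y k = x + real k * pi / real n" for k
  have cos_eq: "complex_of_real (cos t) ^ (2 * m)
      = (\<Sum>j\<le>2 * m. of_nat ((2 * m) choose j) / 2 ^ (2 * m) * cis (2 * of_int (int j - int m) * t))" for t
  proof -
    have "complex_of_real (cos t) = (cis t + cis (-t)) / 2"
      by (simp add: complex_eq_iff)
    then have "complex_of_real (cos t) ^ (2 * m) = (cis t + cis (-t)) ^ (2 * m) / 2 ^ (2 * m)"
      by (simp only: power_divide)
    also have "\<dots> = (\<Sum>j\<le>2 * m. of_nat ((2 * m) choose j) * (cis t ^ j * cis (-t) ^ (2 * m - j)) / 2 ^ (2 * m))"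
      by (simp add: binomial_ring sum_divide_distrib mult.assoc)
    also have "\<dots> = (\<Sum>j\<le>2 * m. of_nat ((2 * m) choose j) / 2 ^ (2 * m) * cis (2 * of_int (int j - int m) * t))"
    proof (intro sum.cong refl)
      fix j assume "j \<in> {..2 * m}"
      then have "cis t ^ j * cis (-t) ^ (2 * m - j) = cis (2 * of_int (int j - int m) * t)"
        unfolding Complex.DeMoivre cis_mult
        by (intro arg_cong[where f = cis]) (simp add: of_nat_diff algebra_simps)
      then show "of_nat ((2 * m) choose j) * (cis t ^ j * cis (-t) ^ (2 * m - j)) / 2 ^ (2 * m)
          = of_nat ((2 * m) choose j) / 2 ^ (2 * m) * cis (2 * of_int (int j - int m) * t)"
        by simp
    qed
    finally show ?thesis .
  qed
  have "complex_of_real (\<Sum>k<n. cos (y k) ^ (2 * m)) = (\<Sum>k<n. complex_of_real (cos (y k)) ^ (2 * m))"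
    by simp
  also have "\<dots> = (\<Sum>j\<le>2 * m. of_nat ((2 * m) choose j) / 2 ^ (2 * m) *
       (\<Sum>k<n. cis (2 * of_int (int j - int m) * y k)))"
    unfolding cos_eq by (subst sum.swap) (simp only: sum_distrib_left)
  also have "\<dots> = (\<Sum>j\<le>2 * m. if j = m then of_nat ((2 * m) choose m) / 2 ^ (2 * m) * of_nat n else 0)"
  proof (intro sum.cong refl)
    fix j assume j: "j \<in> {..2 * m}"
    have "(\<Sum>k<n. cis (2 * of_int (int j - int m) * y k)) = 0" if "j \<noteq> m"
      unfolding y_def by (rule sum_cis_equispaced) (use that j assms in auto)
    then show "of_nat ((2 * m) choose j) / 2 ^ (2 * m) * (\<Sum>k<n. cis (2 * of_int (int j - int m) * y k))
        = (if j = m then of_nat ((2 * m) choose m) / 2 ^ (2 * m) * of_nat n else 0)"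
      by auto
  qed
  also have "\<dots> = complex_of_real (real n * real ((2 * m) choose m) / 2 ^ (2 * m))"
    by (simp add: mult.commute)
  finally show ?thesis
    unfolding of_real_eq_iff y_def .
qed

section \<open>Configurations and their angles\<close>

lemma inner_cis: "cis a \<bullet> cis b = cos (a - b)"
  by (simp add: inner_complex_def cos_diff)

lemma unit_circle_cis:
  assumes "v \<in> sphere 0 1"
  obtains x where "v = cis x"
  using assms cis_Arg[of v] by (metis dist_0_norm mem_sphere norm_zero sgn_eq scaleR_one
      div_by_1 of_real_1 zero_neq_one)

lemma polarization_le:
  assumes "p > 0" "\<And>x. potential p \<omega> (cis x) \<le> c"
  shows "polarization p \<omega> \<le> c"
  using polarization_attained[OF assms(1), of \<omega>] assms(2) unit_circle_cis by metis

lemma potential_cis_le_polarization: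
  "p > 0 \<Longrightarrow> potential p \<omega> (cis x) \<le> polarization p \<omega>"
  by (rule potential_le_polarization) auto

lemma equally_distributed_in_configs:
  "equally_distributed_half_circle n \<omega> \<Longrightarrow> \<omega> \<in> configs n"
  by (auto simp: equally_distributed_half_circle_def configs_def)

lemma equally_distributed_potential:
  assumes "equally_distributed_half_circle n \<omega>"
  obtains a where "\<And>p x. potential p \<omega> (cis x) = (\<Sum>k<n. \<bar>cos (a - x + real k * pi / real n)\<bar> powr p)"
proof -
  obtain a where \<omega>: "\<omega> = {# cis (a + real k * pi / real n). k \<in># mset_set {0..<n} #}"
    using assms unfolding equally_distributed_half_circle_def by blast
  have "potential p \<omega> (cis x) = (\<Sum>k<n. \<bar>cos (a - x + real k * pi / real n)\<bar> powr p)" for p x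
  proof -
    have "potential p \<omega> (cis x) = (\<Sum>k<n. \<bar>cos (x - (a + real k * pi / real n))\<bar> powr p)"
      by (simp add: \<omega> potential_def inner_cis image_mset.compositionality comp_def
          sum_unfold_sum_mset lessThan_atLeast0)
    also have "\<dots> = (\<Sum>k<n. \<bar>cos (a - x + real k * pi / real n)\<bar> powr p)"
    proof (intro sum.cong refl)
      fix k
      show "\<bar>cos (x - (a + real k * pi / real n))\<bar> powr p = \<bar>cos (a - x + real k * pi / real n)\<bar> powr p"
        using cos_minus[of "x - (a + real k * pi / real n)"] by (simp add: algebra_simps)
    qed
    finally show ?thesis .
  qed
  then show ?thesis by (rule that)
qed

text \<open>The potential sees angles only modulo \<open>pi\<close>. Sorting them and continuing by
  \<open>pi\<close> per period turns a rotation of the configuration into an index shift. The offset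
  \<open>pi / 2\<close> replaces cosine by sine, whose absolute value has a concave arch on
  \<open>[0, pi]\<close>.\<close>

lemma configs_angles:
  assumes n: "n \<ge> 1" and \<omega>: "\<omega> \<in> configs n"
  obtains t :: "nat \<Rightarrow> real" where
    "mono t" "\<And>i. t (i + n) = t i + pi"
    "\<And>p v. potential p \<omega> (cis (v + pi / 2)) = (\<Sum>i<n. \<bar>sin (t i - v)\<bar> powr p)"
proof -
  obtain f where f: "\<And>i. f i \<in> sphere 0 1" and \<omega>f: "\<omega> = mset (map f [0..<n])"
    using \<omega> by (auto simp: configs_iff_map)
  then have "\<forall>i. \<exists>x. f i = cis x"
    using unit_circle_cis by metis
  then obtain b where b: "\<And>i. f i = cis (b i)" by metis
  \<comment> \<open>The representative of \<open>b i\<close> modulo \<open>pi\<close> in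
    \<open>[0, pi)\<close>.\<close>
  define a where "a i = pi * frac (b i / pi)" for i
  have a_range: "0 \<le> a i" "a i \<le> pi" for i
    using frac_ge_0[of "b i / pi"] frac_lt_1[of "b i / pi"] by (auto simp: a_def mult_le_cancel_left1)
  have b_eq: "b i = a i + of_int \<lfloor>b i / pi\<rfloor> * pi" for i
    by (simp add: a_def frac_def field_simps)
  have inner: "\<bar>cis (v + pi / 2) \<bullet> f i\<bar> = \<bar>sin (a i - v)\<bar>" for v i
  proof -
    have "cos (v + pi / 2 - b i) = sin (b i - v)"
      by (simp add: cos_diff sin_diff cos_add sin_add algebra_simps)
    also have "b i - v = a i - v + of_int \<lfloor>b i / pi\<rfloor> * pi"
      using b_eq[of i] by linarith
    finally show ?thesis
      by (simp only: b inner_cis abs_sin_add_int_pi)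
  qed
  define ts where "ts = sort (map a [0..<n])"
  have len: "length ts = n" and srt: "sorted ts" by (simp_all add: ts_def)
  have ts_range: "0 \<le> ts ! i" "ts ! i \<le> pi" if "i < n" for i
  proof -
    have "ts ! i \<in> set ts" using that len by simp
    then show "0 \<le> ts ! i" "ts ! i \<le> pi" using a_range by (auto simp: ts_def)
  qed
  \<comment> \<open>Monotonicity survives the passage to the next block because all entries of
    \<open>ts\<close> lie between 0 and \<open>pi\<close>.\<close>
  define t where "t i = ts ! (i mod n) + real (i div n) * pi" for i
  show ?thesis
  proof (rule that)
    show "mono t"
      unfolding mono_iff_le_Suc
    proof
      fix i
      have "i mod n < n" using n by simp
      show "t i \<le> t (Suc i)"
      proof (cases "Suc (i mod n) = n")
        case True
        then show ?thesis
          using ts_range(2)[OF \<open>i mod n < n\<close>] ts_range(1)[of 0] n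
          by (simp add: t_def mod_Suc div_Suc algebra_simps)
      next
        case False
        then have "ts ! (i mod n) \<le> ts ! Suc (i mod n)"
          using \<open>i mod n < n\<close> srt len by (intro sorted_nth_mono) auto
        then show ?thesis
          using False by (simp add: t_def mod_Suc div_Suc)
      qed
    qed
    show "t (i + n) = t i + pi" for i
      using n by (simp add: t_def algebra_simps)
    fix p v
    have "potential p \<omega> (cis (v + pi / 2)) = (\<Sum>x\<leftarrow>map a [0..<n]. \<bar>sin (x - v)\<bar> powr p)"
      by (simp add: \<omega>f potential_def comp_def inner flip: sum_mset_sum_list mset_map)
    also have "\<dots> = (\<Sum>x\<leftarrow>ts. \<bar>sin (x - v)\<bar> powr p)"
      by (simp only: ts_def mset_sort mset_map flip: sum_mset_sum_list)
    also have "\<dots> = (\<Sum>i<n. \<bar>sin (t i - v)\<bar> powr p)"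
      by (simp add: sum_list_sum_nth len t_def lessThan_atLeast0)
    finally show "potential p \<omega> (cis (v + pi / 2)) = (\<Sum>i<n. \<bar>sin (t i - v)\<bar> powr p)" .
  qed
qed

section \<open>Even exponents\<close>

lemma abs_powr_even:
  assumes "m \<ge> 1"
  shows "\<bar>x\<bar> powr (2 * real m) = x ^ (2 * m)"
proof (cases "x = 0")
  case False
  then have "\<bar>x\<bar> powr real (2 * m) = \<bar>x\<bar> ^ (2 * m)" by (intro powr_realpow) simp
  then show ?thesis by (simp add: power_even_abs)
qed (use assms in simp)

text \<open>This is \<open>n\<close> times the mean of \<open>cos x ^ (2 * m)\<close> over the
  circle.\<close>

definition even_level :: "nat \<Rightarrow> nat \<Rightarrow> real" where
  "even_level n m = real n * real ((2 * m) choose m) / 2 ^ (2 * m)"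

text \<open>After exchanging the sums, each vector contributes an equispaced cosine sum, whose value
  does not depend on the direction of the vector.\<close>

lemma sum_potential_even:
  assumes "m \<ge> 1" "m < n" and \<omega>: "\<omega> \<in> configs n"
  shows "(\<Sum>k<n. potential (2 * real m) \<omega> (cis (x + real k * pi / real n))) = real n * even_level n m"
proof -
  obtain t where t: "\<And>p v. potential p \<omega> (cis (v + pi / 2)) = (\<Sum>i<n. \<bar>sin (t i - v)\<bar> powr p)"
    by (rule configs_angles[of n \<omega>]) (use assms in auto)
  have pot: "potential (2 * real m) \<omega> (cis y) = (\<Sum>i<n. cos (y - t i) ^ (2 * m))" for y
  proof -
    have "sin (t i - (y - pi / 2)) = cos (y - t i)" for i
      by (simp add: sin_diff cos_diff sin_add cos_add)
    then show ?thesis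
      using t[of "2 * real m" "y - pi / 2"] by (simp add: abs_powr_even[OF assms(1)])
  qed
  have "(\<Sum>k<n. potential (2 * real m) \<omega> (cis (x + real k * pi / real n)))
      = (\<Sum>i<n. \<Sum>k<n. cos ((x - t i) + real k * pi / real n) ^ (2 * m))"
    unfolding pot by (subst sum.swap) (simp add: algebra_simps)
  also have "\<dots> = real n * even_level n m"
    by (simp add: sum_cos_power_equispaced[OF assms(2)] even_level_def)
  finally show ?thesis .
qed

lemma even_level_le_polarization:
  assumes "m \<ge> 1" "m < n" "\<omega> \<in> configs n"
  shows "even_level n m \<le> polarization (2 * real m) \<omega>"
proof -
  have "real n * even_level n m \<le> (\<Sum>k<n. polarization (2 * real m) \<omega>)"
    unfolding sum_potential_even[OF assms, of 0, symmetric]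
    by (intro sum_mono potential_cis_le_polarization) (use assms in auto)
  then show ?thesis using assms by simp
qed

lemma equally_distributed_potential_even:
  assumes "m \<ge> 1" "m < n" and eq: "equally_distributed_half_circle n \<omega>"
  shows "potential (2 * real m) \<omega> (cis x) = even_level n m"
proof -
  obtain a where a: "\<And>p x. potential p \<omega> (cis x) = (\<Sum>k<n. \<bar>cos (a - x + real k * pi / real n)\<bar> powr p)"
    using equally_distributed_potential[OF eq] by blast
  show ?thesis
    unfolding a abs_powr_even[OF assms(1)] sum_cos_power_equispaced[OF assms(2)] even_level_def ..
qed

text \<open>The samples lie below their mean, so the deficits are nonnegative with sum zero and all
  vanish. Since \<open>x\<close> is arbitrary, the sample \<open>k = 0\<close> covers every
  direction.\<close>

lemma potential_even_of_polarization_le: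
  assumes "m \<ge> 1" "m < n" "\<omega> \<in> configs n" and le: "polarization (2 * real m) \<omega> \<le> even_level n m"
  shows "potential (2 * real m) \<omega> (cis x) = even_level n m"
proof -
  let ?U = "\<lambda>k. potential (2 * real m) \<omega> (cis (x + real k * pi / real n))"
  have U: "?U k \<le> even_level n m" for k
    using potential_cis_le_polarization[of "2 * real m" \<omega>] le assms(1) by (meson le_trans order_trans
        of_nat_0_less_iff zero_less_mult_iff less_le_trans zero_less_one zero_less_numeral)
  have "(\<Sum>k<n. even_level n m - ?U k) = 0"
    by (simp add: sum_subtractf sum_potential_even[OF assms(1-3)])
  then have "\<forall>k\<in>{..<n}. even_level n m - ?U k = 0"
    by (subst (asm) sum_nonneg_eq_0_iff) (use U in auto)
  from bspec[OF this, of 0] show ?thesis using assms by simp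
qed

section \<open>Exponents at most one\<close>

text \<open>Cycle lemma: the total over a period is zero, so the prefix sums \<open>S\<close> are
  periodic and attain a minimum; starting there, no later prefix sum is smaller.\<close>

lemma exists_rotation_nonneg_partial_sums:
  fixes e :: "nat \<Rightarrow> real"
  assumes n: "n \<ge> 1" and per: "\<And>i. e (i + n) = e i" and zero: "(\<Sum>i<n. e i) = 0"
  obtains r where "\<And>k. 0 \<le> (\<Sum>i<k. e (r + i))"
proof -
  define S where "S j = (\<Sum>i<j. e i)" for j
  have S_per: "S (j + n) = S j" for j
    by (induction j) (simp_all add: S_def zero per)
  have S_mult: "S (j + l * n) = S j" for j l
    by (induction l) (simp_all, metis S_per add.assoc add.commute)
  have S_mod: "S j = S (j mod n)" for j
    using S_mult[of "j mod n" "j div n"] by simp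
  have split: "S (r + k) = S r + (\<Sum>i<k. e (r + i))" for r k
    by (induction k) (simp_all add: S_def)
  have ne: "finite (S ` {..<n})" "S ` {..<n} \<noteq> {}" using n by (auto simp: lessThan_empty_iff)
  obtain r where r: "r < n" "S r = Min (S ` {..<n})"
    using Min_in[OF ne] by auto
  have "S r \<le> S j" for j
    unfolding r(2) S_mod[of j] using n by (intro Min_le) auto
  then show ?thesis
    using that[of r] split[of r] by (metis le_add_same_cancel1)
qed

text \<open>Abel summation: a nonnegative partial sum can only lose when its weight drops from
  \<open>c m\<close> to \<open>c (Suc m)\<close>. When the full sum of \<open>d\<close> is zero, the
  weighted sum is thus nonnegative.\<close>

lemma decreasing_weights_sum_ge:
  fixes c d :: "nat \<Rightarrow> real"
  assumes "\<And>i. i < m \<Longrightarrow> c (Suc i) \<le> c i"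
    and "\<And>k. k \<le> m \<Longrightarrow> 0 \<le> (\<Sum>i<k. d i)"
  shows "c m * (\<Sum>i\<le>m. d i) \<le> (\<Sum>i\<le>m. c i * d i)"
  using assms
proof (induction m)
  case (Suc m)
  have "c (Suc m) * (\<Sum>i\<le>m. d i) \<le> c m * (\<Sum>i\<le>m. d i)"
    using Suc.prems(1)[of m] Suc.prems(2)[of "Suc m"]
    by (intro mult_right_mono) (simp_all add: lessThan_Suc_atMost)
  also have "\<dots> \<le> (\<Sum>i\<le>m. c i * d i)"
    using Suc by simp
  finally show ?case by (simp add: distrib_left)
qed simp

section \<open>Tangent lines of powers of the sine\<close>

text \<open>The derivative of \<open>sin x powr p\<close> on the open interval from 0 to
  \<open>pi\<close>.\<close>

definition sin_powr_slope :: "real \<Rightarrow> real \<Rightarrow> real" where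
  "sin_powr_slope p x = p * sin x powr (p - 1) * cos x"

text \<open>Dividing by \<open>a powr p\<close> leaves Bernoulli's inequality for
  \<open>b / a\<close>, which is Young's inequality for \<open>b / a\<close> and 1 with weights
  \<open>p\<close> and \<open>1 - p\<close>.\<close>

lemma powr_le_tangent:
  fixes a b p :: real
  assumes p: "0 < p" "p \<le> 1" and "0 < a" "0 \<le> b"
  shows "b powr p \<le> a powr p + p * a powr (p - 1) * (b - a)"
proof -
  have "(b / a) powr p \<le> 1 + p * (b / a - 1)"
  proof (cases "b = 0")
    case False
    then show ?thesis
      using Youngs_inequality_0[of p "1 - p" "b / a" 1] assms by (simp add: algebra_simps)
  qed (use p in simp)
  then have "a powr p * (b / a) powr p \<le> a powr p * (1 + p * (b / a - 1))"
    by (intro mult_left_mono) auto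
  moreover have "a powr p * (b / a) powr p = b powr p"
    using assms by (simp flip: powr_mult)
  moreover have "a powr p * (1 + p * (b / a - 1)) = a powr p + p * a powr (p - 1) * (b - a)"
    using assms by (simp add: powr_diff field_simps)
  ultimately show ?thesis by simp
qed

lemma sin_le_tangent:
  assumes "x \<in> {0..pi}" "y \<in> {0..pi}"
  shows "sin y \<le> sin x + cos x * (y - x)"
proof -
  have "- cos x * (y - x) \<le> (- sin y) - (- sin x)"
    by (rule f''_imp_f'[of "{0..pi}" "\<lambda>x. - sin x" _ "\<lambda>x. sin x"])
      (use assms in \<open>auto intro!: derivative_eq_intros sin_ge_zero\<close>)
  then show ?thesis by simp
qed

text \<open>The tangent bounds of the power and of the sine compose because the power has
  nonnegative slope. The point of tangency is interior, where \<open>sin x > 0\<close>;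
  \<open>y\<close> may be an endpoint.\<close>

lemma sin_powr_le_tangent:
  assumes p: "0 < p" "p \<le> 1" and x: "0 < x" "x < pi" and y: "0 \<le> y" "y \<le> pi"
  shows "\<bar>sin y\<bar> powr p \<le> \<bar>sin x\<bar> powr p + sin_powr_slope p x * (y - x)"
proof -
  have sx: "sin x > 0" and sy: "sin y \<ge> 0"
    using x y by (auto intro: sin_gt_zero sin_ge_zero)
  have "sin y powr p \<le> sin x powr p + p * sin x powr (p - 1) * (sin y - sin x)"
    using p sx sy by (rule powr_le_tangent)
  also have "p * sin x powr (p - 1) * (sin y - sin x) \<le> p * sin x powr (p - 1) * (cos x * (y - x))"
    using sin_le_tangent[of x y] x y p by (intro mult_left_mono) auto
  finally show ?thesis
    using sx sy by (simp add: sin_powr_slope_def mult.assoc)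
qed

text \<open>Add the tangent inequality at \<open>x\<close> evaluated in \<open>y\<close> to the one
  at \<open>y\<close> evaluated in \<open>x\<close>.\<close>

lemma sin_powr_slope_antimono:
  assumes p: "0 < p" "p \<le> 1" and xy: "0 < x" "x \<le> y" "y < pi"
  shows "sin_powr_slope p y \<le> sin_powr_slope p x"
proof (cases "x = y")
  case False
  have "0 \<le> (sin_powr_slope p x - sin_powr_slope p y) * (y - x)"
    using sin_powr_le_tangent[of p x y] sin_powr_le_tangent[of p y x] assms
    by (simp add: algebra_simps)
  then show ?thesis using False xy by (simp add: zero_le_mult_iff)
qed simp

section \<open>The extremal value for exponents at most one\<close>

text \<open>The angles are equally spaced and measured from the middle of a gap, hence symmetric
  about \<open>pi / 2\<close>.\<close>

definition concave_level :: "real \<Rightarrow> nat \<Rightarrow> real" where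
  "concave_level p n = (\<Sum>i<n. \<bar>sin (pi / (2 * real n) + real i * pi / real n)\<bar> powr p)"

lemma midpoint_angle:
  assumes "i < n"
  shows "0 < pi / (2 * real n) + real i * pi / real n" "pi / (2 * real n) + real i * pi / real n < pi"
proof -
  show "0 < pi / (2 * real n) + real i * pi / real n"
    using assms by (intro add_pos_nonneg) auto
  have "pi / (2 * real n) + real i * pi / real n = (1 + 2 * real i) * pi / (2 * real n)"
    using assms by (simp add: field_simps)
  also have "\<dots> < pi"
    using assms by (simp add: pos_divide_less_eq mult.commute)
  finally show "pi / (2 * real n) + real i * pi / real n < pi" .
qed

lemma sum_sin_powr_equispaced_le:
  assumes n: "n \<ge> 1" and p: "0 < p" "p \<le> 1"
  shows "(\<Sum>i<n. \<bar>sin (x + real i * pi / real n)\<bar> powr p) \<le> concave_level p n"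
proof -
  let ?h = "\<lambda>t. \<bar>sin t\<bar> powr p"
  let ?y = "\<lambda>i. pi / (2 * real n) + real i * pi / real n"
  \<comment> \<open>Removing \<open>j\<close> whole steps leaves a start \<open>z\<close> in
    \<open>[0, pi / n]\<close>, so that all \<open>n\<close> angles lie on one arch of the
    sine.\<close>
  define j where "j = \<lfloor>x * real n / pi\<rfloor>"
  define z where "z = x - of_int j * pi / real n"
  have "of_int j \<le> x * real n / pi" "x * real n / pi \<le> of_int j + 1"
    unfolding j_def by linarith+
  then have "of_int j * pi / real n \<le> x" "x \<le> (of_int j + 1) * pi / real n"
    using n by (simp_all add: pos_divide_le_eq pos_le_divide_eq)
  then have z: "0 \<le> z" "z \<le> pi / real n"
    by (simp_all add: z_def distrib_right add_divide_distrib)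
  \<comment> \<open>Reflection in \<open>pi / 2\<close> permutes the midpoints and negates the
    slopes, so these add up to zero.\<close>
  have slope_reflect: "sin_powr_slope p (?y (n - Suc i)) = - sin_powr_slope p (?y i)" if "i < n" for i
  proof -
    have "?y (n - Suc i) = pi - ?y i"
      using that by (simp add: of_nat_diff field_simps)
    then show ?thesis
      by (simp only: sin_powr_slope_def sin_pi_minus cos_pi_minus)
  qed
  have "(\<Sum>i<n. sin_powr_slope p (?y i)) = (\<Sum>i<n. sin_powr_slope p (?y (n - Suc i)))"
    by (rule sum.nat_diff_reindex[symmetric])
  also have "\<dots> = - (\<Sum>i<n. sin_powr_slope p (?y i))"
    unfolding sum_negf[symmetric] by (intro sum.cong refl slope_reflect) simp
  finally have slopes: "(\<Sum>i<n. sin_powr_slope p (?y i)) = 0" by simp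
  have "(\<Sum>i<n. ?h (x + real i * pi / real n))
      = (\<Sum>i<n. ?h (z + real i * pi / real n + of_int j * pi / real n))"
    by (simp add: z_def algebra_simps)
  also have "\<dots> = (\<Sum>i<n. ?h (z + real i * pi / real n))"
    by (rule sum_equispaced_shift_int) (use n in simp_all)
  \<comment> \<open>Every displacement from its midpoint equals \<open>z - pi / (2 * n)\<close>, so
    the linear terms are a common factor times the vanishing slope sum.\<close>
  also have "\<dots> \<le> (\<Sum>i<n. ?h (?y i) + sin_powr_slope p (?y i) * ((z + real i * pi / real n) - ?y i))"
  proof (intro sum_mono sin_powr_le_tangent p midpoint_angle)
    fix i assume "i \<in> {..<n}"
    then show "i < n" "i < n" by simp_all
    show "0 \<le> z + real i * pi / real n" using z by simp
    have "z + real i * pi / real n \<le> (real i + 1) * pi / real n"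
      using z by (simp add: field_simps add_divide_distrib)
    also have "\<dots> \<le> pi"
      using \<open>i < n\<close> by (simp add: pos_divide_le_eq mult.commute)
    finally show "z + real i * pi / real n \<le> pi" .
  qed
  also have "\<dots> = concave_level p n + (\<Sum>i<n. sin_powr_slope p (?y i)) * (z - pi / (2 * real n))"
    by (simp add: concave_level_def sum.distrib sum_distrib_right)
  finally show ?thesis using slopes by simp
qed

lemma concave_level_le_polarization:
  assumes n: "n \<ge> 1" and p: "0 < p" "p \<le> 1" and \<omega>: "\<omega> \<in> configs n"
  shows "concave_level p n \<le> polarization p \<omega>"
proof -
  obtain t where t_mono: "mono t" and t_per: "\<And>i. t (i + n) = t i + pi"
    and t: "\<And>p v. potential p \<omega> (cis (v + pi / 2)) = (\<Sum>i<n. \<bar>sin (t i - v)\<bar> powr p)"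
    using configs_angles[OF n \<omega>] by blast
  let ?y = "\<lambda>i. pi / (2 * real n) + real i * pi / real n"
  \<comment> \<open>\<open>A\<close> is the mean deviation from equal spacing. Over a period both
    \<open>t\<close> and the equal spacing grow by \<open>pi\<close>, so \<open>e\<close> is
    periodic.\<close>
  define A where "A = (\<Sum>i<n. t i - real i * pi / real n) / real n"
  define e where "e i = t i - real i * pi / real n - A" for i
  have e_per: "e (i + n) = e i" for i
    using n by (simp add: e_def t_per field_simps)
  have e_sum: "(\<Sum>i<n. e i) = 0"
    using n by (simp add: e_def sum_subtractf A_def)
  obtain r where r: "\<And>k. 0 \<le> (\<Sum>i<k. e (r + i))"
    using exists_rotation_nonneg_partial_sums[OF n e_per e_sum] by blast
  \<comment> \<open>Chosen so that, measured from \<open>v\<close>, the deviation of the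
    \<open>i\<close>-th angle from the \<open>i\<close>-th midpoint is exactly
    \<open>e (r + i)\<close>.\<close>
  define v where "v = A + real r * pi / real n - pi / (2 * real n)"
  define x where "x i = t (r + i) - v" for i
  have x_diff: "x i - ?y i = e (r + i)" for i
    by (simp add: x_def v_def e_def add_divide_distrib algebra_simps)
  have shift_sum: "(\<Sum>i<n. g (j + i)) = (\<Sum>i<n. g i)" if "\<And>i. g (i + n) = g i" for g :: "nat \<Rightarrow> real" and j
  proof (induction j)
    case (Suc j)
    have "(\<Sum>i<n. g (Suc j + i)) = (\<Sum>i<Suc n. g (j + i)) - g j"
      by (simp only: sum.lessThan_Suc_shift) simp
    also have "\<dots> = (\<Sum>i<n. g (j + i))" using that[of j] by simp
    finally show ?case using Suc by simp
  qed simp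
  have e_sum_r: "(\<Sum>i<n. e (r + i)) = 0"
    using shift_sum[of e r] e_per e_sum by simp
  obtain m where m: "n = Suc m" using n by (cases n) auto
  \<comment> \<open>The partial sums of lengths 1 and \<open>n - 1\<close> confine the extreme
    angles, hence all of them, to the open interval where the tangents exist.\<close>
  have first: "?y 0 \<le> x 0"
    using r[of 1] x_diff[of 0] by simp
  have last: "x m \<le> ?y m"
    using r[of m] e_sum_r x_diff[of m] by (simp add: m)
  have x_mono: "x i \<le> x j" if "i \<le> j" for i j
    using t_mono that by (simp add: x_def monoD)
  have "0 < ?y 0" "?y m < pi"
    by (rule midpoint_angle, simp add: m)+
  then have x_pos: "0 < x i" and x_less: "i < n \<Longrightarrow> x i < pi" for i
    using x_mono[of 0 i] x_mono[of i m] first last m by linarith+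
  \<comment> \<open>The slopes decrease along the sorted angles and the deviations sum to zero, so
    Abel summation applies.\<close>
  have "0 \<le> (\<Sum>i\<le>m. sin_powr_slope p (x i) * e (r + i))"
    using decreasing_weights_sum_ge[of m "\<lambda>i. sin_powr_slope p (x i)" "\<lambda>i. e (r + i)"]
      r e_sum_r p x_pos x_less x_mono
    by (simp add: m lessThan_Suc_atMost sin_powr_slope_antimono del: sum.lessThan_Suc sum.atMost_Suc)
  then have slopes: "0 \<le> (\<Sum>i<n. sin_powr_slope p (x i) * (x i - ?y i))"
    unfolding x_diff by (simp only: m lessThan_Suc_atMost)
  \<comment> \<open>Karamata's inequality through tangents at the angles \<open>x i\<close>,
    evaluated at the midpoints.\<close>
  have "concave_level p n \<le> (\<Sum>i<n. \<bar>sin (x i)\<bar> powr p + sin_powr_slope p (x i) * (?y i - x i))"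
    unfolding concave_level_def using p x_pos x_less midpoint_angle
    by (intro sum_mono sin_powr_le_tangent) (auto intro: less_imp_le)
  also have "\<dots> = (\<Sum>i<n. \<bar>sin (x i)\<bar> powr p) - (\<Sum>i<n. sin_powr_slope p (x i) * (x i - ?y i))"
    by (simp add: algebra_simps flip: sum_subtractf)
  also have "\<dots> \<le> (\<Sum>i<n. \<bar>sin (x i)\<bar> powr p)"
    using slopes by simp
  also have "\<dots> = (\<Sum>i<n. \<bar>sin (t i - v)\<bar> powr p)"
    unfolding x_def
  proof (rule shift_sum)
    fix i
    have "t (i + n) - v = (t i - v) + pi" by (simp add: t_per)
    then show "\<bar>sin (t (i + n) - v)\<bar> powr p = \<bar>sin (t i - v)\<bar> powr p"
      by (simp only: abs_sin_add_pi)
  qed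
  also have "\<dots> \<le> polarization p \<omega>"
    unfolding t[symmetric] by (rule potential_cis_le_polarization[OF p(1)])
  finally show ?thesis .
qed

lemma equally_distributed_polarization_le:
  assumes n: "n \<ge> 1" and p: "0 < p" "p \<le> 1" and eq: "equally_distributed_half_circle n \<omega>"
  shows "polarization p \<omega> \<le> concave_level p n"
proof (rule polarization_le[OF p(1)])
  fix x
  obtain a where a: "\<And>p x. potential p \<omega> (cis x) = (\<Sum>k<n. \<bar>cos (a - x + real k * pi / real n)\<bar> powr p)"
    using equally_distributed_potential[OF eq] by blast
  have "potential p \<omega> (cis x) = (\<Sum>k<n. \<bar>sin (a - x + pi / 2 + real k * pi / real n)\<bar> powr p)"
    unfolding a
  proof (intro sum.cong refl)
    fix k
    have "a - x + pi / 2 + real k * pi / real n = (a - x + real k * pi / real n) + pi / 2" by simp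
    then show "\<bar>cos (a - x + real k * pi / real n)\<bar> powr p = \<bar>sin (a - x + pi / 2 + real k * pi / real n)\<bar> powr p"
      by (simp only: sin_add) simp
  qed
  also have "\<dots> \<le> concave_level p n"
    by (rule sum_sin_powr_equispaced_le[OF n p])
  finally show "potential p \<omega> (cis x) \<le> concave_level p n" .
qed

section \<open>Closed forms for even and odd \<open>n\<close>\<close>

lemma concave_level_shift:
  assumes n: "n \<ge> 1" and x: "\<And>k. x k + pi / 2 = pi / (2 * real n) + real k * pi / real n + real j * pi / real n"
  shows "(\<Sum>k<n. \<bar>cos (x k)\<bar> powr p) = concave_level p n"
proof -
  have "(\<Sum>k<n. \<bar>cos (x k)\<bar> powr p) = (\<Sum>k<n. \<bar>sin (x k + pi / 2)\<bar> powr p)"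
    by (simp add: sin_add)
  also have "\<dots> = concave_level p n"
    unfolding x concave_level_def
    by (rule sum_equispaced_shift[OF n]) simp
  finally show ?thesis .
qed

lemma concave_level_even:
  assumes n: "n \<ge> 1" and "even n"
  shows "(\<Sum>k=1..n. \<bar>cos (real k * pi / real n - pi / (2 * real n))\<bar> powr p) = concave_level p n"
proof -
  obtain m where m: "n = 2 * m" using \<open>even n\<close> by blast
  have "(\<Sum>k=1..n. \<bar>cos (real k * pi / real n - pi / (2 * real n))\<bar> powr p)
      = (\<Sum>k<n. \<bar>cos (real (Suc k) * pi / real n - pi / (2 * real n))\<bar> powr p)"
    unfolding One_nat_def by (rule sum.atLeast1_atMost_eq)
  also have "\<dots> = concave_level p n"
    \<comment> \<open>For \<open>n = 2 * m\<close>, the offset \<open>pi / 2\<close> is exactly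
      \<open>m\<close> steps.\<close>
    by (rule concave_level_shift[OF n, where j = m]) (use n in \<open>simp add: m field_simps\<close>)
  finally show ?thesis .
qed

lemma concave_level_odd:
  assumes n: "n \<ge> 1" and "odd n"
  shows "(\<Sum>k=1..n. \<bar>cos (real k * pi / real n)\<bar> powr p) = concave_level p n"
proof -
  obtain m where m: "n = 2 * m + 1" using \<open>odd n\<close> by (elim oddE)
  have "(\<Sum>k=1..n. \<bar>cos (real k * pi / real n)\<bar> powr p)
      = (\<Sum>k<n. \<bar>cos (real (Suc k) * pi / real n)\<bar> powr p)"
    unfolding One_nat_def by (rule sum.atLeast1_atMost_eq)
  also have "\<dots> = concave_level p n"
    \<comment> \<open>Here \<open>pi / 2\<close> is \<open>m\<close> steps and a half step; the half
      step is the midpoint offset, and one more step comes from the sum starting at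
      \<open>k = 1\<close>.\<close>
    by (rule concave_level_shift[OF n, where j = "Suc m"]) (simp add: m divide_simps, simp add: algebra_simps)
  finally show ?thesis .
qed

section \<open>From matching bounds to the minimum\<close>

lemma is_arg_min_min_polarization:
  assumes "\<omega> \<in> configs n" "polarization p \<omega> \<le> c" "\<And>\<omega>'. \<omega>' \<in> configs n \<Longrightarrow> c \<le> polarization p \<omega>'"
  shows "is_arg_min (polarization p) (\<lambda>\<omega>'. \<omega>' \<in> configs n) \<omega>" "min_polarization p n = c"
proof -
  show "is_arg_min (polarization p) (\<lambda>\<omega>'. \<omega>' \<in> configs n) \<omega>"
    using assms by (force simp: is_arg_min_def not_less)
  have c: "polarization p \<omega> = c" using assms(2) assms(3)[OF assms(1)] by (rule antisym)
  show "min_polarization p n = c"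
    unfolding min_polarization_def
    by (rule cInf_eq_minimum) (use assms c in auto)
qed

lemma exists_equally_distributed: "\<exists>\<omega>. equally_distributed_half_circle n \<omega>"
  unfolding equally_distributed_half_circle_def by blast

theorem proposition5:
  fixes n :: nat and p :: real
  assumes "n \<ge> 1"
  shows
    "(0 < p \<and> p \<le> 1 \<or> p \<in> {2 * real k |k. k \<in> {1..<n}} \<longrightarrow>
       (\<forall>\<omega>. equally_distributed_half_circle n \<omega> \<longrightarrow>
          is_arg_min (polarization p) (\<lambda>\<omega>'. \<omega>' \<in> configs n) \<omega>))
     \<and>
     (p \<in> {2 * real k |k. k \<in> {1..<n}} \<longrightarrow>
       (\<forall>\<omega>\<in>configs n. polarization p \<omega> = min_polarization p n \<longrightarrow>
          (\<lambda>v. potential p \<omega> v) constant_on sphere 0 1))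
     \<and>
     (0 < p \<and> p \<le> 1 \<longrightarrow>
       (even n \<longrightarrow> min_polarization p n =
          (\<Sum>k=1..n. \<bar>cos (real k * pi / real n - pi / (2 * real n))\<bar> powr p)) \<and>
       (odd n \<longrightarrow> min_polarization p n =
          (\<Sum>k=1..n. \<bar>cos (real k * pi / real n)\<bar> powr p)))"
proof (intro conjI impI allI ballI)
  fix \<omega>
  assume p: "0 < p \<and> p \<le> 1 \<or> p \<in> {2 * real k |k. k \<in> {1..<n}}"
    and eq: "equally_distributed_half_circle n \<omega>"
  show "is_arg_min (polarization p) (\<lambda>\<omega>'. \<omega>' \<in> configs n) \<omega>"
    using p
  proof
    assume "0 < p \<and> p \<le> 1"
    then show ?thesis
      using assms equally_distributed_in_configs[OF eq] eq
      by (intro is_arg_min_min_polarization(1)[where c = "concave_level p n"]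
          equally_distributed_polarization_le concave_level_le_polarization) auto
  next
    assume "p \<in> {2 * real k |k. k \<in> {1..<n}}"
    then obtain m where m: "m \<ge> 1" "m < n" "p = 2 * real m" by auto
    then show ?thesis
      using even_level_le_polarization[OF m(1,2)] equally_distributed_in_configs[OF eq]
        equally_distributed_potential_even[OF m(1,2) eq]
      by (intro is_arg_min_min_polarization(1)[where c = "even_level n m"] polarization_le) auto
  qed
next
  fix \<omega>
  assume "p \<in> {2 * real k |k. k \<in> {1..<n}}" and \<omega>: "\<omega> \<in> configs n"
    and extremal: "polarization p \<omega> = min_polarization p n"
  then obtain m where m: "m \<ge> 1" "m < n" and p: "p = 2 * real m" by auto
  obtain \<omega>' where eq: "equally_distributed_half_circle n \<omega>'"
    using exists_equally_distributed by blast
  \<comment> \<open>One equally distributed set attains the mean value, so every extremal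
    configuration has this value as its polarization.\<close>
  have "min_polarization p n = even_level n m"
    using even_level_le_polarization[OF m] equally_distributed_potential_even[OF m eq] m p
    by (intro is_arg_min_min_polarization(2)[OF equally_distributed_in_configs[OF eq]] polarization_le) auto
  then have "potential p \<omega> (cis x) = even_level n m" for x
    using potential_even_of_polarization_le[OF m \<omega>] extremal p by simp
  then show "(\<lambda>v. potential p \<omega> v) constant_on sphere 0 1"
    unfolding constant_on_def using unit_circle_cis by metis
next
  assume p: "0 < p \<and> p \<le> 1"
  obtain \<omega> where eq: "equally_distributed_half_circle n \<omega>"
    using exists_equally_distributed by blast
  have level: "min_polarization p n = concave_level p n"
    using assms p eq
    by (intro is_arg_min_min_polarization(2)[OF equally_distributed_in_configs[OF eq]]
        equally_distributed_polarization_le concave_level_le_polarization) auto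
  show "min_polarization p n = (\<Sum>k=1..n. \<bar>cos (real k * pi / real n - pi / (2 * real n))\<bar> powr p)"
    if "even n"
    using concave_level_even[OF assms that] level by simp
  show "min_polarization p n = (\<Sum>k=1..n. \<bar>cos (real k * pi / real n)\<bar> powr p)"
    if "odd n"
    using concave_level_odd[OF assms that] level by simp
qed

end
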